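(* Let $K$ be a compact Hausdorff space and let $\mathbb{X}$ be a real Banach space. Let $f\in C(K,\mathbb{X})$ with $\|f\|=1$. Then $f$ is right symmetric in $C(K,\mathbb{X})$ if and only if both of the following hold: (i) $\|f(k)\|=1$ for all $k\in K$; (ii) $f(k)$ is a right symmetric point of $\mathbb{X}$ for all $k\in K$.
   Context: $C(K,\mathbb{X})$ is the Banach space of all continuous functions $f:K\to\mathbb{X}$ with the supremum norm. For a real Banach space $\mathbb{Z}$ and $x,y\in\mathbb{Z}$, $x\perp_B y$ (Birkhoff-James orthogonality) means $\|x+\lambda y\|\ge\|x\|$ for all $\lambda\in\mathbb{R}$. A point $x\in\mathbb{Z}$ is right symmetric (in $\mathbb{Z}$) if for all $y\in\mathbb{Z}$, $y\perp_B x$ implies $x\perp_B y$. *)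

theory Defs
  imports "HOL-Analysis.Analysis"
begin

definition bj_orthogonal :: "'z::real_normed_vector \<Rightarrow> 'z \<Rightarrow> bool"  (infix "\<bottom>\<^sub>B" 50)
  where "x \<bottom>\<^sub>B y \<longleftrightarrow> (\<forall>c::real. norm (x + c *\<^sub>R y) \<ge> norm x)"

definition right_symmetric :: "'z::real_normed_vector \<Rightarrow> bool"
  where "right_symmetric x \<longleftrightarrow> (\<forall>y. y \<bottom>\<^sub>B x \<longrightarrow> x \<bottom>\<^sub>B y)"

text \<open>
  A compact Hausdorff space \<open>K\<close> is rendered as a type \<open>'k\<close> of class \<^class>\<open>t2_space\<close> whose
  universe is compact. The space \<open>C(K,X)\<close> is then the library type \<open>'k \<Rightarrow>\<^sub>C 'x\<close> of bounded
  continuous functions with the supremum norm: the following fact shows that, \<open>K\<close> being compact,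
  it contains every continuous function from \<open>K\<close> to \<open>X\<close>.
\<close>

lemma continuous_on_compact_UNIV_bcontfun:
  fixes g :: "'k::t2_space \<Rightarrow> 'x::banach"
  assumes "compact (UNIV :: 'k set)" and "continuous_on UNIV g"
  shows "g \<in> bcontfun"
  using compact_continuous_image[OF assms(2,1)] assms(2)
  by (simp add: bcontfun_def compact_imp_bounded)

end

theory Submission
  imports Defs
begin

text \<open>
  Call \<open>y\<close> \<^emph>\<open>positively orthogonal\<close> to \<open>x\<close> if \<open>\<parallel>y + cx\<parallel> \<ge> \<parallel>y\<parallel>\<close> for all \<open>c \<ge> 0\<close>. By
  compactness, \<open>g \<bottom>\<^sub>B f\<close> in \<open>C(K,X)\<close> yields points \<open>k, l\<close> at which \<open>g\<close> attains its norm,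
  with \<open>g(k)\<close> positively orthogonal to \<open>f(k)\<close> and \<open>g(l)\<close> to \<open>-f(l)\<close>. A right symmetric point reverses
  positive orthogonality as well, and this transports back to \<open>f \<bottom>\<^sub>B g\<close> as \<open>\<parallel>f(k)\<parallel> = \<parallel>f(l)\<parallel> = 1\<close>.

  Conversely, if \<open>\<parallel>f(k)\<parallel> < 1\<close>, move \<open>f\<close> near \<open>k\<close> towards the unit vector opposite to \<open>f(k)\<close>;
  if \<open>y \<bottom>\<^sub>B f(k)\<close> but \<open>\<parallel>f(k) + y\<parallel> < 1\<close>, take \<open>y\<close> near \<open>k\<close> and \<open>-\<parallel>y\<parallel>f\<close> away from \<open>k\<close>. In both
  cases the resulting \<open>g\<close> satisfies \<open>g \<bottom>\<^sub>B f\<close> but not \<open>f \<bottom>\<^sub>B g\<close>.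
\<close>

section \<open>Scaling, and orthogonality along a half-line\<close>

lemma norm_convex_combination_le:
  fixes a b :: "'a::real_normed_vector"
  assumes "0 \<le> u" "u \<le> 1"
  shows "norm ((1 - u) *\<^sub>R a + u *\<^sub>R b) \<le> (1 - u) * norm a + u * norm b"
  using norm_triangle_ineq[of "(1 - u) *\<^sub>R a" "u *\<^sub>R b"] assms by simp

lemma bj_orthogonal_scaleR_left:
  assumes "y \<bottom>\<^sub>B x"
  shows "(a *\<^sub>R y) \<bottom>\<^sub>B x"
proof (cases "a = 0")
  case False
  have "norm (a *\<^sub>R y) \<le> norm (a *\<^sub>R y + c *\<^sub>R x)" for c
  proof -
    have "a *\<^sub>R y + c *\<^sub>R x = a *\<^sub>R (y + (c / a) *\<^sub>R x)"
      using False by (simp add: scaleR_add_right)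
    then show ?thesis
      using assms unfolding bj_orthogonal_def
      by (metis norm_scaleR mult_left_mono abs_ge_zero)
  qed
  then show ?thesis
    unfolding bj_orthogonal_def by blast
qed (simp add: bj_orthogonal_def)

lemma bj_orthogonal_uminus_right: "y \<bottom>\<^sub>B x \<Longrightarrow> y \<bottom>\<^sub>B (- x)"
  unfolding bj_orthogonal_def by (metis scaleR_minus_left scaleR_minus_right)

text \<open>Orthogonality is homogeneous in its left argument: with \<open>y\<close>, every multiple
  \<open>c y\<close> is orthogonal to \<open>x\<close>, so testing the coefficient 1
  suffices.\<close>

lemma right_symmetricI:
  fixes x :: "'a::real_normed_vector"
  assumes "\<And>y. y \<bottom>\<^sub>B x \<Longrightarrow> norm x \<le> norm (x + y)"
  shows "right_symmetric x"
  unfolding right_symmetric_def bj_orthogonal_def[of x]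
  using assms bj_orthogonal_scaleR_left by blast

text \<open>
  If \<open>a\<close> minimises \<open>\<parallel>y + cx\<parallel>\<close> over \<open>c\<close>, then \<open>y + ax \<bottom>\<^sub>B x\<close>; positive orthogonality allows \<open>a \<le> 0\<close>,
  and then \<open>x + cy\<close> is a multiple, by a factor at least \<open>1\<close>, of some \<open>x + t(y + ax)\<close>.
\<close>
lemma right_symmetric_half_line:
  fixes x y :: "'a::real_normed_vector"
  assumes "right_symmetric x"
    and pos: "\<And>c. 0 \<le> c \<Longrightarrow> norm y \<le> norm (y + c *\<^sub>R x)"
    and "0 \<le> c"
  shows "norm x \<le> norm (x + c *\<^sub>R y)"
proof (cases "x = 0")
  case False
  \<comment> \<open>For \<open>c < -R\<close> the term \<open>c x\<close> has norm at least
    \<open>2 * norm y\<close>, so \<open>y + c x\<close> is no shorter than \<open>y\<close>. With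
    \<open>pos\<close> for \<open>c >= 0\<close>, a minimum over the compact interval is
    global.\<close>
  define R where "R = 2 * norm y / norm x"
  have "R \<ge> 0" by (simp add: R_def)
  obtain a where a: "a \<in> {-R..0}"
    and min: "\<And>c. c \<in> {-R..0} \<Longrightarrow> norm (y + a *\<^sub>R x) \<le> norm (y + c *\<^sub>R x)"
  proof -
    have "continuous_on {-R..0} (\<lambda>c. norm (y + c *\<^sub>R x))"
      by (intro continuous_intros)
    then show ?thesis
      using continuous_attains_inf[of "{-R..0}" "\<lambda>c. norm (y + c *\<^sub>R x)"] \<open>R \<ge> 0\<close> that by force
  qed
  have le_y: "norm (y + a *\<^sub>R x) \<le> norm y"
    using min[of 0] \<open>R \<ge> 0\<close> by simp
  have glob: "norm (y + a *\<^sub>R x) \<le> norm (y + c *\<^sub>R x)" for c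
  proof -
    consider "0 \<le> c" | "c \<in> {-R..0}" | "c < -R" by fastforce
    then show ?thesis
    proof cases
      case 1
      then show ?thesis using pos[of c] le_y by linarith
    next
      case 2
      then show ?thesis by (rule min)
    next
      case 3
      have "2 * norm y = R * norm x" using False by (simp add: R_def)
      also have "\<dots> \<le> \<bar>c\<bar> * norm x" using 3 by (intro mult_right_mono) auto
      finally have "2 * norm y \<le> norm (c *\<^sub>R x)" by simp
      then show ?thesis
        using le_y norm_triangle_ineq2[of "c *\<^sub>R x" "- y"] by (simp add: add.commute)
    qed
  qed
  have "norm (y + a *\<^sub>R x) \<le> norm ((y + a *\<^sub>R x) + c *\<^sub>R x)" for c
    using glob[of "a + c"] by (simp add: scaleR_add_left add.assoc)
  then have orth: "x \<bottom>\<^sub>B (y + a *\<^sub>R x)"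
    using assms(1) unfolding right_symmetric_def bj_orthogonal_def by blast
  define s where "s = 1 - c * a"
  have "c * a \<le> 0" using a \<open>0 \<le> c\<close> by (simp add: mult_nonneg_nonpos)
  then have s: "s \<ge> 1" by (simp add: s_def)
  have "s *\<^sub>R (x + (c / s) *\<^sub>R (y + a *\<^sub>R x)) = (s + c * a) *\<^sub>R x + c *\<^sub>R y"
    using s by (simp add: algebra_simps)
  also have "\<dots> = x + c *\<^sub>R y" by (simp add: s_def)
  finally have eq: "x + c *\<^sub>R y = s *\<^sub>R (x + (c / s) *\<^sub>R (y + a *\<^sub>R x))" ..
  have "norm x \<le> norm (x + (c / s) *\<^sub>R (y + a *\<^sub>R x))"
    using orth by (simp add: bj_orthogonal_def)
  also have "\<dots> \<le> s * norm (x + (c / s) *\<^sub>R (y + a *\<^sub>R x))"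
    using mult_right_mono[OF s norm_ge_zero] by simp
  also have "\<dots> = norm (x + c *\<^sub>R y)"
    using s by (simp add: eq)
  finally show ?thesis .
qed simp

section \<open>Sufficiency: compactness and pointwise orthogonality\<close>

lemma bcontfun_norm_attained:
  fixes f :: "'k::t2_space \<Rightarrow>\<^sub>C 'x::real_normed_vector"
  assumes "compact (UNIV :: 'k set)"
  obtains k where "norm (apply_bcontfun f k) = norm f"
proof -
  have "continuous_on UNIV (\<lambda>k. norm (apply_bcontfun f k))"
    by (intro continuous_on_norm continuous_on_apply_bcontfun)
  then obtain k where "\<And>l. norm (apply_bcontfun f l) \<le> norm (apply_bcontfun f k)"
    using continuous_attains_sup[OF assms] by auto
  then have "norm f \<le> norm (apply_bcontfun f k)" by (rule norm_bound)
  then show ?thesis using that norm_bounded[of f k] by force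
qed

text \<open>The sets \<open>A c\<close> are closed, nonempty because \<open>g + c f\<close> attains
  its norm, and increasing in \<open>c > 0\<close> by convexity. Compactness then gives one point
  serving all \<open>c\<close>.\<close>

lemma bcontfun_bj_orthogonal_half_line:
  fixes f g :: "'k::t2_space \<Rightarrow>\<^sub>C 'x::real_normed_vector"
  assumes K: "compact (UNIV :: 'k set)" and "g \<bottom>\<^sub>B f"
  obtains k where "\<And>c. 0 \<le> c \<Longrightarrow> norm g \<le> norm (apply_bcontfun g k + c *\<^sub>R apply_bcontfun f k)"
proof -
  define A where "A c = {k. norm g \<le> norm (apply_bcontfun g k + c *\<^sub>R apply_bcontfun f k)}" for c
  have closed: "closed (A c)" for c
    unfolding A_def by (intro closed_Collect_le continuous_intros continuous_on_apply_bcontfun)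
  have nonempty: "A c \<noteq> {}" for c
  proof -
    obtain k where k: "norm (apply_bcontfun (g + c *\<^sub>R f) k) = norm (g + c *\<^sub>R f)"
      by (rule bcontfun_norm_attained[OF K])
    have "norm g \<le> norm (apply_bcontfun (g + c *\<^sub>R f) k)"
      using \<open>g \<bottom>\<^sub>B f\<close> k by (simp only: bj_orthogonal_def)
    then have "k \<in> A c" by (simp add: A_def)
    then show ?thesis by blast
  qed
  have mono: "A s \<subseteq> A t" if "0 < s" "s \<le> t" for s t
  proof
    fix k assume "k \<in> A s"
    define u where "u = s / t"
    have u: "0 < u" "u \<le> 1" using that by (auto simp: u_def)
    let ?g = "apply_bcontfun g k" and ?f = "apply_bcontfun f k"
    have "?g + s *\<^sub>R ?f = (1 - u) *\<^sub>R ?g + u *\<^sub>R (?g + t *\<^sub>R ?f)"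
      using that by (simp add: u_def algebra_simps)
    then have "norm g \<le> (1 - u) * norm ?g + u * norm (?g + t *\<^sub>R ?f)"
      using norm_convex_combination_le[of u ?g "?g + t *\<^sub>R ?f"] u \<open>k \<in> A s\<close> by (simp add: A_def)
    moreover have "(1 - u) * norm ?g \<le> (1 - u) * norm g"
      using u norm_bounded[of g k] by (intro mult_left_mono) auto
    ultimately have "u * norm g \<le> u * norm (?g + t *\<^sub>R ?f)"
      by (simp add: algebra_simps)
    then show "k \<in> A t" using u by (simp add: A_def)
  qed
  have "UNIV \<inter> (\<Inter>c\<in>{0<..}. A c) \<noteq> {}"
  proof (rule compact_imp_fip_image[OF K closed])
    fix I :: "real set" assume I: "finite I" "I \<subseteq> {0<..}"
    show "UNIV \<inter> (\<Inter>c\<in>I. A c) \<noteq> {}"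
    proof (cases "I = {}")
      case False
      then have "A (Min I) \<subseteq> (\<Inter>c\<in>I. A c)"
        using I by (intro INT_greatest mono) (auto simp: subset_iff)
      then show ?thesis using nonempty[of "Min I"] by blast
    qed simp
  qed
  then obtain k where k: "\<And>c. 0 < c \<Longrightarrow> k \<in> A c" by auto
  \<comment> \<open>Letting \<open>c\<close> decrease to 0 adds the case \<open>c = 0\<close>:
    \<open>g\<close> attains its norm at \<open>k\<close>.\<close>
  have "norm g \<le> norm (apply_bcontfun g k + 0 *\<^sub>R apply_bcontfun f k)"
  proof (rule tendsto_lowerbound)
    show "((\<lambda>c. norm (apply_bcontfun g k + c *\<^sub>R apply_bcontfun f k)) \<longlongrightarrow>
        norm (apply_bcontfun g k + 0 *\<^sub>R apply_bcontfun f k)) (at_right 0)"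
      by (intro tendsto_intros)
    show "\<forall>\<^sub>F c in at_right 0. norm g \<le> norm (apply_bcontfun g k + c *\<^sub>R apply_bcontfun f k)"
      using k by (intro eventually_mono[OF eventually_at_right_less]) (simp add: A_def)
  qed simp
  then have "norm g \<le> norm (apply_bcontfun g k + c *\<^sub>R apply_bcontfun f k)" if "0 \<le> c" for c
    using k[of c] that by (cases "c = 0") (auto simp: A_def)
  then show ?thesis by (rule that)
qed

lemma right_symmetric_bcontfunI:
  fixes f :: "'k::t2_space \<Rightarrow>\<^sub>C 'x::real_normed_vector"
  assumes K: "compact (UNIV :: 'k set)"
    and peak: "\<And>k. norm (apply_bcontfun f k) = norm f"
    and rs: "\<And>k. right_symmetric (apply_bcontfun f k)"
  shows "right_symmetric f"
  unfolding right_symmetric_def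
proof (intro allI impI)
  fix g assume "g \<bottom>\<^sub>B f"
  obtain k where k: "\<And>c. 0 \<le> c \<Longrightarrow> norm g \<le> norm (apply_bcontfun g k + c *\<^sub>R apply_bcontfun f k)"
    using bcontfun_bj_orthogonal_half_line[OF K \<open>g \<bottom>\<^sub>B f\<close>] by blast
  obtain l where l: "\<And>c. 0 \<le> c \<Longrightarrow> norm g \<le> norm (apply_bcontfun g l + c *\<^sub>R apply_bcontfun (- f) l)"
    using bcontfun_bj_orthogonal_half_line[OF K bj_orthogonal_uminus_right[OF \<open>g \<bottom>\<^sub>B f\<close>]] by blast
  have pos: "norm f \<le> norm (f + c *\<^sub>R g)" if "0 \<le> c" for c
  proof -
    have "norm (apply_bcontfun f k) \<le> norm (apply_bcontfun f k + c *\<^sub>R apply_bcontfun g k)"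
      by (rule right_symmetric_half_line[OF rs order_trans[OF norm_bounded k] that])
    then show ?thesis using peak[of k] norm_bounded[of "f + c *\<^sub>R g" k] by simp
  qed
  have neg: "norm f \<le> norm (f - c *\<^sub>R g)" if "0 \<le> c" for c
  proof -
    \<comment> \<open>Both signs are moved from \<open>f l\<close> to \<open>g l\<close>, so that
      the right symmetry of \<open>f l\<close> itself applies.\<close>
    have "norm (- apply_bcontfun g l) \<le> norm (- apply_bcontfun g l + c *\<^sub>R apply_bcontfun f l)"
      if "0 \<le> c" for c
      using order_trans[OF norm_bounded l[OF that], of l]
      by (simp add: norm_minus_commute)
    then have "norm (apply_bcontfun f l) \<le> norm (apply_bcontfun f l + c *\<^sub>R (- apply_bcontfun g l))"
      by (rule right_symmetric_half_line[OF rs _ that])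
    then show ?thesis using peak[of l] norm_bounded[of "f - c *\<^sub>R g" l] by simp
  qed
  have "norm f \<le> norm (f + c *\<^sub>R g)" for c
    using pos[of c] neg[of "- c"] by (cases "0 \<le> c") auto
  then show "f \<bottom>\<^sub>B g" by (simp add: bj_orthogonal_def)
qed

section \<open>Necessity: perturbations localised near a point\<close>

text \<open>The bump is a truncated affine function of \<open>p\<close> itself, so wherever it is
  nonzero the strict bound \<open>p l < r\<close> is available.\<close>

lemma bump_at_point:
  fixes p :: "'k::topological_space \<Rightarrow> real"
  assumes "continuous_on UNIV p" "p k < r"
  obtains h where "continuous_on UNIV h" "h k = 1"
    "\<And>l. 0 \<le> h l" "\<And>l. h l \<le> (1::real)" "\<And>l. r \<le> p l \<Longrightarrow> h l = 0"
proof
  let ?h = "\<lambda>l. max 0 (min 1 ((r - p l) / (r - p k)))"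
  show "continuous_on UNIV ?h"
    using assms by (intro continuous_intros assms(1)) simp
  show "?h k = 1" using assms by simp
  show "?h l = 0" if "r \<le> p l" for l
    using that assms by (simp add: divide_nonpos_pos min.coboundedI2)
qed auto

lemma right_symmetric_bcontfun_norm:
  fixes f :: "'k::t2_space \<Rightarrow>\<^sub>C 'x::banach"
  assumes K: "compact (UNIV :: 'k set)" and f: "norm f = 1" and rs: "right_symmetric f"
  shows "norm (apply_bcontfun f k) = 1"
proof (rule ccontr)
  assume "norm (apply_bcontfun f k) \<noteq> 1"
  then have lt: "norm (apply_bcontfun f k) < 1" using norm_bounded[of f k] f by simp
  obtain m where m: "norm (apply_bcontfun f m) = 1" using bcontfun_norm_attained[OF K, of f] f by auto
  define a where "a = norm (apply_bcontfun f k)"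
  \<comment> \<open>If \<open>f k = 0\<close>, any unit vector serves; \<open>f m\<close> is one at
    hand.\<close>
  obtain u where u: "norm u = 1" and fk: "apply_bcontfun f k = a *\<^sub>R u"
  proof (cases "apply_bcontfun f k = 0")
    case True
    then show ?thesis using that[of "apply_bcontfun f m"] m by (simp add: a_def)
  next
    case False
    then show ?thesis using that[of "sgn (apply_bcontfun f k)"] by (simp add: sgn_div_norm a_def)
  qed
  obtain r where r: "norm (apply_bcontfun f k) < r" "r < 1" using dense[OF lt] by blast
  have "0 \<le> r" using r norm_ge_zero by (meson less_imp_le order_trans)
  obtain h where h: "continuous_on UNIV h" "h k = 1" "\<And>l. 0 \<le> h l" "\<And>l. h l \<le> (1::real)"
    "\<And>l. r \<le> norm (apply_bcontfun f l) \<Longrightarrow> h l = 0"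
    using bump_at_point[OF continuous_on_norm[OF continuous_on_apply_bcontfun] r(1)] by blast
  let ?G = "\<lambda>l. (1 - h l) *\<^sub>R apply_bcontfun f l + h l *\<^sub>R (- u)"
  have "?G \<in> bcontfun"
    by (intro continuous_on_compact_UNIV_bcontfun K continuous_intros continuous_on_apply_bcontfun h)
  then obtain g where "?G = apply_bcontfun g" by (rule bcontfunE)
  then have g: "apply_bcontfun g l = ?G l" for l by (rule fun_cong[OF sym])
  have gle: "norm (apply_bcontfun g l) \<le> 1" for l
  proof -
    have "norm (apply_bcontfun g l) \<le> (1 - h l) * norm (apply_bcontfun f l) + h l * 1"
      using norm_convex_combination_le[OF h(3,4), of l "apply_bcontfun f l" "- u"] u by (simp add: g)
    also have "\<dots> \<le> (1 - h l) * 1 + h l * 1"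
      using h norm_bounded[of f l] f by (intro add_mono mult_left_mono) auto
    finally show ?thesis by simp
  qed
  have "norm g \<le> 1" using gle by (rule norm_bound)
  \<comment> \<open>Nonnegative \<open>c\<close> is tested at \<open>m\<close>, where
    \<open>g\<close> equals \<open>f\<close>, and negative \<open>c\<close> at \<open>k\<close>,
    where \<open>g\<close> is \<open>- u\<close>.\<close>
  have "norm g \<le> norm (g + c *\<^sub>R f)" for c
  proof (cases "0 \<le> c")
    case True
    have "h m = 0" using h(5) m r by simp
    then have "apply_bcontfun (g + c *\<^sub>R f) m = (1 + c) *\<^sub>R apply_bcontfun f m"
      by (simp add: g scaleR_add_left)
    then have "norm (apply_bcontfun (g + c *\<^sub>R f) m) = 1 + c" using m True by simp
    then show ?thesis using norm_bounded[of "g + c *\<^sub>R f" m] \<open>norm g \<le> 1\<close> True by linarith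
  next
    case False
    have "apply_bcontfun (g + c *\<^sub>R f) k = (c * a - 1) *\<^sub>R u"
      using h(2) by (simp add: g fk scaleR_diff_left)
    then have "norm (apply_bcontfun (g + c *\<^sub>R f) k) = \<bar>c * a - 1\<bar>"
      using u by simp
    moreover have "c * a \<le> 0"
      using False by (simp add: a_def mult_nonpos_nonneg)
    ultimately show ?thesis using norm_bounded[of "g + c *\<^sub>R f" k] \<open>norm g \<le> 1\<close> by linarith
  qed
  then have "f \<bottom>\<^sub>B g" using rs by (simp add: right_symmetric_def bj_orthogonal_def)
  \<comment> \<open>This \<open>t\<close> balances two bounds for \<open>f - t g\<close>:
    \<open>1 - t\<close> where \<open>g\<close> equals \<open>f\<close>, and \<open>r + t\<close>
    where \<open>f\<close> has norm below \<open>r\<close>.\<close>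
  define t where "t = (1 - r) / 2"
  have t: "0 < t" "t < 1" "r + t = 1 - t" using r \<open>0 \<le> r\<close> by (auto simp: t_def field_simps)
  have "norm (apply_bcontfun (f + (- t) *\<^sub>R g) l) \<le> 1 - t" for l
  proof (cases "r \<le> norm (apply_bcontfun f l)")
    case True
    then have "apply_bcontfun (f + (- t) *\<^sub>R g) l = (1 - t) *\<^sub>R apply_bcontfun f l"
      using h(5) by (simp add: g scaleR_diff_left)
    then have "norm (apply_bcontfun (f + (- t) *\<^sub>R g) l) = (1 - t) * norm (apply_bcontfun f l)"
      using t by simp
    also have "\<dots> \<le> (1 - t) * 1"
      using t norm_bounded[of f l] f by (intro mult_left_mono) auto
    finally show ?thesis by simp
  next
    case False
    have "norm (apply_bcontfun (f + (- t) *\<^sub>R g) l) \<le> norm (apply_bcontfun f l) + t * norm (apply_bcontfun g l)"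
      using norm_triangle_ineq4[of "apply_bcontfun f l" "t *\<^sub>R apply_bcontfun g l"] t by simp
    also have "\<dots> \<le> r + t * 1"
      using False t gle by (intro add_mono mult_left_mono) auto
    finally show ?thesis using t by simp
  qed
  then have "norm (f + (- t) *\<^sub>R g) \<le> 1 - t" by (rule norm_bound)
  moreover have "1 \<le> norm (f + (- t) *\<^sub>R g)"
    using \<open>f \<bottom>\<^sub>B g\<close> f unfolding bj_orthogonal_def by metis
  ultimately show False using t by simp
qed

lemma right_symmetric_bcontfun_apply:
  fixes f :: "'k::t2_space \<Rightarrow>\<^sub>C 'x::banach"
  assumes K: "compact (UNIV :: 'k set)" and f: "norm f = 1" and rs: "right_symmetric f"
    and k: "norm (apply_bcontfun f k) = 1"
  shows "right_symmetric (apply_bcontfun f k)"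
proof (rule right_symmetricI, rule ccontr)
  fix y
  assume y: "y \<bottom>\<^sub>B apply_bcontfun f k"
    and "\<not> norm (apply_bcontfun f k) \<le> norm (apply_bcontfun f k + y)"
  then have lt: "norm (apply_bcontfun f k + y) < 1" using k by simp
  have "y \<noteq> 0" using lt k by auto
  have "norm y \<le> 2" using norm_triangle_ineq4[of "apply_bcontfun f k + y" "apply_bcontfun f k"] lt k by simp
  obtain r where r: "norm (apply_bcontfun f k + y) < r" "r < 1" using dense[OF lt] by blast
  obtain h where h: "continuous_on UNIV h" "h k = 1" "\<And>l. 0 \<le> h l" "\<And>l. h l \<le> (1::real)"
    "\<And>l. r \<le> norm (apply_bcontfun f l + y) \<Longrightarrow> h l = 0"
    using bump_at_point[OF continuous_on_norm[OF
      continuous_on_add[OF continuous_on_apply_bcontfun continuous_on_const]] r(1)] by blast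
  \<comment> \<open>Both ingredients have norm at most \<open>norm y\<close>, and the value at
    \<open>k\<close> is \<open>y\<close>; hence \<open>y\<close> being orthogonal to
    \<open>f k\<close> gives \<open>g\<close> orthogonal to \<open>f\<close>.\<close>
  let ?G = "\<lambda>l. (1 - h l) *\<^sub>R (- norm y *\<^sub>R apply_bcontfun f l) + h l *\<^sub>R y"
  have "?G \<in> bcontfun"
    by (intro continuous_on_compact_UNIV_bcontfun K continuous_intros continuous_on_apply_bcontfun h)
  then obtain g where "?G = apply_bcontfun g" by (rule bcontfunE)
  then have g: "apply_bcontfun g l = ?G l" for l by (rule fun_cong[OF sym])
  have f1: "norm (apply_bcontfun f l) \<le> 1" for l using norm_bounded[of f l] f by simp
  have "norm (apply_bcontfun g l) \<le> norm y" for l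
  proof -
    have "norm (apply_bcontfun g l) \<le> (1 - h l) * norm (- norm y *\<^sub>R apply_bcontfun f l) + h l * norm y"
      unfolding g by (rule norm_convex_combination_le[OF h(3,4)])
    also have "\<dots> \<le> (1 - h l) * norm y + h l * norm y"
      using h f1[of l] by (intro add_mono mult_left_mono) (auto simp: mult_left_le)
    finally show ?thesis by (simp add: algebra_simps)
  qed
  then have "norm g \<le> norm y" by (rule norm_bound)
  have "norm g \<le> norm (g + c *\<^sub>R f)" for c
  proof -
    have "norm y \<le> norm (apply_bcontfun (g + c *\<^sub>R f) k)"
      using y h(2) by (simp add: g bj_orthogonal_def)
    then show ?thesis using norm_bounded[of "g + c *\<^sub>R f" k] \<open>norm g \<le> norm y\<close> by linarith
  qed
  then have "f \<bottom>\<^sub>B g" using rs by (simp add: right_symmetric_def bj_orthogonal_def)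
  \<comment> \<open>The first bound is for \<open>f\<close> shrunk by the factor
    \<open>1 - norm y / 2\<close>, which lies in [0,1) as \<open>0 < norm y <= 2\<close>. The second
    is for \<open>f + y/2\<close>, the midpoint of \<open>f\<close> and \<open>f + y\<close>, where
    the latter has norm below \<open>r\<close>.\<close>
  define q where "q = max (1 - norm y / 2) ((1 + r) / 2)"
  have "q < 1" using \<open>y \<noteq> 0\<close> r by (simp add: q_def)
  have "norm (apply_bcontfun (f + (1/2) *\<^sub>R g) l) \<le> q" for l
  proof -
    let ?f = "apply_bcontfun f l"
    have "apply_bcontfun (f + (1/2) *\<^sub>R g) l =
        (1 - h l) *\<^sub>R ((1 - norm y / 2) *\<^sub>R ?f) + h l *\<^sub>R (?f + (1/2) *\<^sub>R y)"
      by (simp add: g algebra_simps diff_divide_distrib)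
    then have "norm (apply_bcontfun (f + (1/2) *\<^sub>R g) l)
        \<le> (1 - h l) * norm ((1 - norm y / 2) *\<^sub>R ?f) + h l * norm (?f + (1/2) *\<^sub>R y)"
      using norm_convex_combination_le[OF h(3,4)] by metis
    also have "\<dots> \<le> (1 - h l) * q + h l * q"
    proof (rule add_mono)
      have "norm ((1 - norm y / 2) *\<^sub>R ?f) \<le> 1 - norm y / 2"
        using \<open>norm y \<le> 2\<close> f1[of l] by (simp add: mult_left_le)
      then have "norm ((1 - norm y / 2) *\<^sub>R ?f) \<le> q" by (simp add: q_def)
      then show "(1 - h l) * norm ((1 - norm y / 2) *\<^sub>R ?f) \<le> (1 - h l) * q"
        using h(4)[of l] by (intro mult_left_mono) auto
      show "h l * norm (?f + (1/2) *\<^sub>R y) \<le> h l * q"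
      proof (cases "r \<le> norm (?f + y)")
        case False
        have "?f + (1/2) *\<^sub>R y = (1 - 1/2) *\<^sub>R ?f + (1/2) *\<^sub>R (?f + y)"
          by (simp add: algebra_simps flip: scaleR_add_left)
        then have "norm (?f + (1/2) *\<^sub>R y) \<le> (1 - 1/2) * norm ?f + (1/2) * norm (?f + y)"
          using norm_convex_combination_le[of "1/2" ?f "?f + y"] by simp
        also have "\<dots> \<le> q" unfolding q_def using False f1[of l] by (intro max.coboundedI2) (simp add: field_simps)
        finally show ?thesis using h(3)[of l] by (intro mult_left_mono) auto
      qed (simp add: h(5))
    qed
    finally show ?thesis by (simp add: algebra_simps)
  qed
  then have "norm (f + (1/2) *\<^sub>R g) \<le> q" by (rule norm_bound)
  moreover have "1 \<le> norm (f + (1/2) *\<^sub>R g)"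
    using \<open>f \<bottom>\<^sub>B g\<close> f unfolding bj_orthogonal_def by metis
  ultimately show False using \<open>q < 1\<close> by simp
qed

theorem theorem3p11:
  fixes f :: "'k::t2_space \<Rightarrow>\<^sub>C 'x::banach"
  assumes "compact (UNIV :: 'k set)"
    and "norm f = 1"
  shows "right_symmetric f \<longleftrightarrow>
    (\<forall>k. norm (apply_bcontfun f k) = 1) \<and> (\<forall>k. right_symmetric (apply_bcontfun f k))"
  using right_symmetric_bcontfun_norm[OF assms] right_symmetric_bcontfun_apply[OF assms]
    right_symmetric_bcontfunI[OF assms(1), of f] assms(2) by auto

end
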